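(* Let $f : B(\Omega,\mathcal{A})\rightarrow \mathbb{R}$ be a monotone pricing rule. Then the following are equivalent: (i) $f$ has no bid-ask spreads and satisfies the Discount Certificate-Call Parity (DCP); (ii) $f$ is a Šipoš pricing rule.
   Context: $\Omega$ is a set (finite or infinite) endowed with a $\sigma$-algebra $\mathcal{A}$, and $B(\Omega,\mathcal{A})$ is the set of all bounded, $\mathcal{A}$-measurable functions $x:\Omega\to\mathbb{R}$, with pointwise operations and pointwise order ($\vee$, $\wedge$ are pointwise maximum and minimum). For $A\in\mathcal{A}$, $\boldsymbol{1}_A$ is the indicator function of $A$. For $x\in B(\Omega,\mathcal{A})$, $x^+ := x\vee 0$ and $x^-:=(-x)\vee 0$. A pricing rule is a function $f:B(\Omega,\mathcal{A})\to\mathbb{R}$ that is not identically zero. It is monotone if $x\ge x'$ implies $f(x)\ge f(x')$. It has no bid-ask spreads if $f(x)=-f(-x)$ for all $x\in B(\Omega,\mathcal{A})$. For $x\in B(\Omega,\mathcal{A})$ and $k\ge 0$, let $c_{x,k}=(x-k\boldsymbol{1}_\Omega)^+$ (call option) and $d_{x,k}=x\wedge k\boldsymbol{1}_\Omega$ (discount certificate). DCP: $f(x)=f(c_{x,k})+f(d_{x,k})$ for all $x\in B(\Omega,\mathcal{A})$ and all $k\ge 0$. A capacity on $(\Omega,\mathcal{A})$ is a set function $v:\mathcal{A}\to\mathbb{R}$ with $v(\emptyset)=0$ and $v(A)\le v(B)$ whenever $A\subseteq B$, $A,B\in\mathcal{A}$. The Choquet integral of $x\in B(\Omega,\mathcal{A})$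 with respect to $v$ is $$\int^C x\,dv:=\int_{-\infty}^0\big(v(\{x\geq t\})-v(\Omega)\big)\,dt + \int_0^{+\infty}v(\{x\geq t\})\,dt ,$$ and the Šipoš integral is $\int^S x\,dv:=\int^C x^+\,dv-\int^C x^-\,dv$. $f$ is a Šipoš pricing rule if there is a capacity $v$ such that $f(x)=\int^S x\,dv$ for all $x\in B(\Omega,\mathcal{A})$. *)

theory Defs
  imports "HOL-Analysis.Analysis"
begin

(* A function on the set Omega is represented by its extension by 0 to the whole type. This makes
   the representative unique, so that a functional on these representatives is exactly a functional
   on the bounded measurable functions on Omega. The pointwise operations below preserve the
   convention because the constant k on Omega is written k * indicator Omega. *)
definition bdd_measurable :: "'a set \<Rightarrow> 'a set set \<Rightarrow> ('a \<Rightarrow> real) set" where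
  "bdd_measurable \<Omega> \<A> =
     {x. x \<in> borel_measurable (sigma \<Omega> \<A>) \<and> bounded (x ` \<Omega>) \<and> (\<forall>\<omega>. \<omega> \<notin> \<Omega> \<longrightarrow> x \<omega> = 0)}"

definition pos_part :: "('a \<Rightarrow> real) \<Rightarrow> 'a \<Rightarrow> real" where
  "pos_part x = (\<lambda>\<omega>. max (x \<omega>) 0)"

definition neg_part :: "('a \<Rightarrow> real) \<Rightarrow> 'a \<Rightarrow> real" where
  "neg_part x = (\<lambda>\<omega>. max (- x \<omega>) 0)"

definition call_option :: "'a set \<Rightarrow> ('a \<Rightarrow> real) \<Rightarrow> real \<Rightarrow> 'a \<Rightarrow> real" where
  "call_option \<Omega> x k = pos_part (\<lambda>\<omega>. x \<omega> - k * indicator \<Omega> \<omega>)"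

definition discount_certificate :: "'a set \<Rightarrow> ('a \<Rightarrow> real) \<Rightarrow> real \<Rightarrow> 'a \<Rightarrow> real" where
  "discount_certificate \<Omega> x k = (\<lambda>\<omega>. min (x \<omega>) (k * indicator \<Omega> \<omega>))"

(* In the following notions only the values of f on bounded measurable functions matter. *)
definition pricing_rule :: "'a set \<Rightarrow> 'a set set \<Rightarrow> (('a \<Rightarrow> real) \<Rightarrow> real) \<Rightarrow> bool" where
  "pricing_rule \<Omega> \<A> f \<longleftrightarrow> (\<exists>x \<in> bdd_measurable \<Omega> \<A>. f x \<noteq> 0)"

definition monotone_rule :: "'a set \<Rightarrow> 'a set set \<Rightarrow> (('a \<Rightarrow> real) \<Rightarrow> real) \<Rightarrow> bool" where
  "monotone_rule \<Omega> \<A> f \<longleftrightarrow>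
     (\<forall>x \<in> bdd_measurable \<Omega> \<A>. \<forall>x' \<in> bdd_measurable \<Omega> \<A>.
        (\<forall>\<omega> \<in> \<Omega>. x \<omega> \<ge> x' \<omega>) \<longrightarrow> f x \<ge> f x')"

definition no_bid_ask_spreads :: "'a set \<Rightarrow> 'a set set \<Rightarrow> (('a \<Rightarrow> real) \<Rightarrow> real) \<Rightarrow> bool" where
  "no_bid_ask_spreads \<Omega> \<A> f \<longleftrightarrow> (\<forall>x \<in> bdd_measurable \<Omega> \<A>. f x = - f (\<lambda>\<omega>. - x \<omega>))"

definition DCP :: "'a set \<Rightarrow> 'a set set \<Rightarrow> (('a \<Rightarrow> real) \<Rightarrow> real) \<Rightarrow> bool" where
  "DCP \<Omega> \<A> f \<longleftrightarrow>
     (\<forall>x \<in> bdd_measurable \<Omega> \<A>. \<forall>k \<ge> 0.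
        f x = f (call_option \<Omega> x k) + f (discount_certificate \<Omega> x k))"

definition capacity :: "'a set set \<Rightarrow> ('a set \<Rightarrow> real) \<Rightarrow> bool" where
  "capacity \<A> v \<longleftrightarrow> v {} = 0 \<and> (\<forall>A \<in> \<A>. \<forall>B \<in> \<A>. A \<subseteq> B \<longrightarrow> v A \<le> v B)"

(* For a capacity v and a bounded measurable x both integrands are monotone and vanish outside a
   bounded interval, so the integrals exist and agree with the improper Riemann integrals. *)
definition choquet_integral :: "'a set \<Rightarrow> ('a set \<Rightarrow> real) \<Rightarrow> ('a \<Rightarrow> real) \<Rightarrow> real" where
  "choquet_integral \<Omega> v x =
     integral {..0} (\<lambda>t. v {\<omega> \<in> \<Omega>. x \<omega> \<ge> t} - v \<Omega>) + integral {0..} (\<lambda>t. v {\<omega> \<in> \<Omega>. x \<omega> \<ge> t})"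

definition sipos_integral :: "'a set \<Rightarrow> ('a set \<Rightarrow> real) \<Rightarrow> ('a \<Rightarrow> real) \<Rightarrow> real" where
  "sipos_integral \<Omega> v x =
     choquet_integral \<Omega> v (pos_part x) - choquet_integral \<Omega> v (neg_part x)"

definition sipos_pricing_rule :: "'a set \<Rightarrow> 'a set set \<Rightarrow> (('a \<Rightarrow> real) \<Rightarrow> real) \<Rightarrow> bool" where
  "sipos_pricing_rule \<Omega> \<A> f \<longleftrightarrow>
     (\<exists>v. capacity \<A> v \<and> (\<forall>x \<in> bdd_measurable \<Omega> \<A>. f x = sipos_integral \<Omega> v x))"

lemma bdd_measurable_iff:
  assumes "sigma_algebra \<Omega> \<A>"
  shows "x \<in> bdd_measurable \<Omega> \<A> \<longleftrightarrow>
    (\<forall>S \<in> sets borel. x -` S \<inter> \<Omega> \<in> \<A>) \<and> (\<exists>b. \<forall>\<omega> \<in> \<Omega>. \<bar>x \<omega>\<bar> \<le> b) \<and> (\<forall>\<omega>. \<omega> \<notin> \<Omega> \<longrightarrow> x \<omega> = 0)"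
proof -
  interpret sigma_algebra \<Omega> \<A> by fact
  show ?thesis
    by (auto simp: bdd_measurable_def measurable_def bounded_iff space_measure_of_conv)
qed

lemma
  assumes x: "x \<in> bdd_measurable \<Omega> \<A>" and \<Omega>: "sigma_algebra \<Omega> \<A>"
  shows uminus_bdd_measurable: "(\<lambda>\<omega>. - x \<omega>) \<in> bdd_measurable \<Omega> \<A>"
    and pos_part_bdd_measurable: "pos_part x \<in> bdd_measurable \<Omega> \<A>"
    and neg_part_bdd_measurable: "neg_part x \<in> bdd_measurable \<Omega> \<A>"
    and call_option_bdd_measurable: "k \<ge> 0 \<Longrightarrow> call_option \<Omega> x k \<in> bdd_measurable \<Omega> \<A>"
    and discount_certificate_bdd_measurable:
      "k \<ge> 0 \<Longrightarrow> discount_certificate \<Omega> x k \<in> bdd_measurable \<Omega> \<A>"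
proof -
  interpret sigma_algebra \<Omega> \<A> by fact
  have m [measurable]: "x \<in> borel_measurable (sigma \<Omega> \<A>)"
    using x by (simp add: bdd_measurable_def)
  have [measurable]: "\<Omega> \<in> sets (sigma \<Omega> \<A>)"
    by simp
  obtain b where b: "\<And>\<omega>. \<omega> \<in> \<Omega> \<Longrightarrow> \<bar>x \<omega>\<bar> \<le> b"
    using x by (auto simp: bdd_measurable_def bounded_iff)
  have z: "\<And>\<omega>. \<omega> \<notin> \<Omega> \<Longrightarrow> x \<omega> = 0"
    using x by (simp add: bdd_measurable_def)
  show "(\<lambda>\<omega>. - x \<omega>) \<in> bdd_measurable \<Omega> \<A>"
    using z b by (auto simp: bdd_measurable_def bounded_iff intro!: exI[of _ b])
  show "pos_part x \<in> bdd_measurable \<Omega> \<A>"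
    using z b by (force simp: bdd_measurable_def pos_part_def bounded_iff intro!: exI[of _ b])
  show "neg_part x \<in> bdd_measurable \<Omega> \<A>"
    using z b by (force simp: bdd_measurable_def neg_part_def bounded_iff intro!: exI[of _ b])
  show "call_option \<Omega> x k \<in> bdd_measurable \<Omega> \<A>" if "k \<ge> 0"
    using z b that
    by (force simp: bdd_measurable_def call_option_def pos_part_def bounded_iff
        intro!: exI[of _ "b + k"])
  show "discount_certificate \<Omega> x k \<in> bdd_measurable \<Omega> \<A>" if "k \<ge> 0"
    using z b that
    by (force simp: bdd_measurable_def discount_certificate_def bounded_iff
        intro!: exI[of _ "b + k"])
qed

end

theory Submission
  imports Defs
begin

text \<open>
  For a monotone \<open>f\<close> satisfying (i) put \<open>v A = f (indicator A)\<close>. DCP makes \<open>f\<close> additive, hence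
  positively homogeneous, on the multiples of an indicator. For \<open>x \<ge> 0\<close> and \<open>0 \<le> s \<le> t\<close>, DCP applied
  to \<open>x \<and> t\<close> writes \<open>f (x \<and> t) - f (x \<and> s)\<close> as the price of the slice \<open>(x \<and> t - s)\<^sup>+\<close>, which lies
  between \<open>(t - s) 1_{x \<ge> t}\<close> and \<open>(t - s) 1_{x \<ge> s}\<close>. These bounds on the increments force
  \<open>t \<mapsto> f (x \<and> t)\<close> to be the indefinite integral of the decreasing function \<open>v {x \<ge> t}\<close>. Conversely,
  DCP for the Sipos integral amounts to splitting the integral of \<open>v {x \<ge> t}\<close> at \<open>t = k\<close>.
\<close>

section \<open>Monotone real functions: integrals, increments and additivity\<close>

lemma integrable_on_antimono_on:
  fixes G :: "real \<Rightarrow> real"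
  assumes "antimono_on {a..b} G"
  shows "G integrable_on {a..b}"
proof -
  have "mono_on {a..b} (\<lambda>t. - G t)"
    using assms by (auto simp: monotone_on_def)
  then have "(\<lambda>t. - (- G t)) integrable_on {a..b}"
    by (intro integrable_neg integrable_on_mono_on)
  then show ?thesis by simp
qed

lemma integral_antimono_on_bounds:
  fixes G :: "real \<Rightarrow> real"
  assumes "antimono_on {a..b} G" "a \<le> b"
  shows "(b - a) * G b \<le> integral {a..b} G" "integral {a..b} G \<le> (b - a) * G a"
proof -
  have G: "G b \<le> G t" "G t \<le> G a" if "t \<in> {a..b}" for t
    using assms that by (auto simp: monotone_on_def)
  have int: "G integrable_on {a..b}"
    using assms by (intro integrable_on_antimono_on)
  have "integral {a..b} (\<lambda>t. G b) \<le> integral {a..b} G"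
    using G int by (intro integral_le) auto
  then show "(b - a) * G b \<le> integral {a..b} G"
    using assms by simp
  have "integral {a..b} G \<le> integral {a..b} (\<lambda>t. G a)"
    using G int by (intro integral_le) auto
  then show "integral {a..b} G \<le> (b - a) * G a"
    using assms by simp
qed

text \<open>A fundamental theorem of calculus for an integrand that may jump: the error
  \<open>D\<close> of the claim changes over \<open>[s, t]\<close> by at most
  \<open>(t - s) * (G s - G t)\<close>. Over \<open>n\<close> equal steps these bounds telescope to
  \<open>(b - a) / n * (G a - G b)\<close>, which is arbitrarily small.\<close>

lemma integral_eq_increment:
  fixes F G :: "real \<Rightarrow> real"
  assumes G: "antimono_on {a..b} G" and "a \<le> b"
    and F: "\<And>s t. a \<le> s \<Longrightarrow> s \<le> t \<Longrightarrow> t \<le> b \<Longrightarrow>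
      (t - s) * G t \<le> F t - F s \<and> F t - F s \<le> (t - s) * G s"
  shows "integral {a..b} G = F b - F a"
proof -
  define D where "D t = F t - integral {a..t} G" for t
  have int: "G integrable_on {a..b}"
    using G by (rule integrable_on_antimono_on)
  \<comment> \<open>\<open>F t - F s\<close> and the integral over \<open>[s, t]\<close> lie in the
    same interval, from \<open>(t - s) * G t\<close> to \<open>(t - s) * G s\<close>, so they differ
    by at most its length.\<close>
  have step: "\<bar>D t - D s\<bar> \<le> (t - s) * (G s - G t)" if st: "a \<le> s" "s \<le> t" "t \<le> b" for s t
  proof -
    have "integral {a..s} G + integral {s..t} G = integral {a..t} G"
      using st int by (intro Henstock_Kurzweil_Integration.integral_combine integrable_on_subinterval[OF int]) auto
    moreover have "antimono_on {s..t} G"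
      using G st by (auto intro: monotone_on_subset)
    note integral_antimono_on_bounds[OF this \<open>s \<le> t\<close>]
    ultimately show ?thesis
      using F[OF st] unfolding D_def by (auto simp: algebra_simps abs_le_iff)
  qed
  \<comment> \<open>Multiplying by \<open>n\<close> puts the estimate in Archimedean form: a
    nonnegative number whose multiples all stay below one bound is 0.\<close>
  have "real n * \<bar>D b - D a\<bar> \<le> (b - a) * (G a - G b)" for n
  proof (cases "n = 0")
    case True
    have "G b \<le> G a" using G \<open>a \<le> b\<close> by (auto simp: monotone_on_def)
    with True \<open>a \<le> b\<close> show ?thesis by simp
  next
    case False
    define h where "h = (b - a) / n"
    define p where "p i = a + real i * h" for i
    have h: "h \<ge> 0" "real n * h = b - a"
      using False \<open>a \<le> b\<close> by (auto simp: h_def)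
    have p: "p 0 = a" "p n = b" "p (Suc i) - p i = h" for i
      using h by (auto simp: p_def algebra_simps)
    have "a \<le> p i" "p i \<le> p (Suc i)" for i
      using h by (auto simp: p_def algebra_simps)
    moreover have "p (Suc i) \<le> b" if "i < n" for i
      using mult_right_mono[of "real (Suc i)" "real n" h] that h by (auto simp: p_def)
    ultimately have "\<bar>D (p (Suc i)) - D (p i)\<bar> \<le> h * (G (p i) - G (p (Suc i)))" if "i < n" for i
      using step[of "p i" "p (Suc i)"] that p(3)[of i] by simp
    then have "(\<Sum>i<n. \<bar>D (p (Suc i)) - D (p i)\<bar>) \<le> (\<Sum>i<n. h * (G (p i) - G (p (Suc i))))"
      by (intro sum_mono) simp
    also have "\<dots> = h * (G a - G b)"
      using sum_lessThan_telescope'[of "\<lambda>i. G (p i)" n] by (simp add: p flip: sum_distrib_left)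
    finally have "\<bar>\<Sum>i<n. D (p (Suc i)) - D (p i)\<bar> \<le> h * (G a - G b)"
      by (rule order_trans[OF sum_abs])
    then have "\<bar>D b - D a\<bar> \<le> h * (G a - G b)"
      using sum_lessThan_telescope[of "\<lambda>i. D (p i)" n] by (simp add: p)
    then have "real n * \<bar>D b - D a\<bar> \<le> real n * (h * (G a - G b))"
      by (intro mult_left_mono) auto
    then show ?thesis by (simp add: h flip: mult.assoc)
  qed
  then have "\<bar>D b - D a\<bar> = 0"
    using real_archimedian_rdiv_eq_0[OF abs_ge_zero] by blast
  then show ?thesis
    by (simp add: D_def)
qed

text \<open>Cauchy's functional equation on the half-line: additivity fixes \<open>g\<close> at
  multiples, and monotonicity squeezes \<open>g (n * t)\<close> between its values at consecutive
  integers.\<close>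

lemma additive_mono_on_nonneg_linear:
  fixes g :: "real \<Rightarrow> real"
  assumes add: "\<And>s t. 0 \<le> s \<Longrightarrow> 0 \<le> t \<Longrightarrow> g (s + t) = g s + g t"
    and mono: "mono_on {0..} g" and "0 \<le> t"
  shows "g t = t * g 1"
proof -
  have g0: "g 0 = 0"
    using add[of 0 0] by simp
  have mult: "g (real n * s) = real n * g s" if "0 \<le> s" for n s
  proof (induction n)
    case (Suc n)
    then show ?case
      using add[of s "real n * s"] that by (simp add: algebra_simps)
  qed (simp add: g0)
  have le: "g s \<le> g t" if "0 \<le> s" "s \<le> t" for s t
    using mono that by (auto simp: monotone_on_def)
  have "real n * \<bar>g t - t * g 1\<bar> \<le> g 1" for n
  proof -
    define m where "m = nat \<lfloor>real n * t\<rfloor>"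
    have m: "real m \<le> real n * t" "real n * t \<le> real m + 1"
      using \<open>0 \<le> t\<close> by (simp_all add: m_def)
    have "real m * g 1 \<le> real n * g t" "real n * g t \<le> (real m + 1) * g 1"
      using le[OF _ m(1)] le[OF _ m(2)] mult[of t n] mult[of 1 m] mult[of 1 "Suc m"] \<open>0 \<le> t\<close>
      by (auto simp: add.commute)
    \<comment> \<open>Here \<open>g 1 \<ge> 0\<close> is used. Now \<open>n * g t\<close> and
      \<open>n * t * g 1\<close> lie in one interval of length \<open>g 1\<close>, whatever
      \<open>n\<close> is.\<close>
    moreover have "real m * g 1 \<le> (real n * t) * g 1" "(real n * t) * g 1 \<le> (real m + 1) * g 1"
      using m le[of 0 1] g0 by (auto intro!: mult_right_mono)
    ultimately have "\<bar>real n * (g t - t * g 1)\<bar> \<le> g 1"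
      by (auto simp: algebra_simps abs_le_iff)
    then show ?thesis
      by (simp add: abs_mult)
  qed
  then have "\<bar>g t - t * g 1\<bar> = 0"
    using real_archimedian_rdiv_eq_0[OF abs_ge_zero] by blast
  then show ?thesis by simp
qed

section \<open>Superlevel sets and the Choquet integral of a positive part\<close>

lemma neg_part_conv_pos_part: "neg_part x = pos_part (\<lambda>\<omega>. - x \<omega>)"
  by (simp add: neg_part_def pos_part_def)

lemma bdd_measurable_le:
  assumes "x \<in> bdd_measurable \<Omega> \<A>"
  shows "\<exists>b\<ge>0. \<forall>\<omega>\<in>\<Omega>. x \<omega> \<le> b"
proof -
  obtain b where b: "\<And>\<omega>. \<omega> \<in> \<Omega> \<Longrightarrow> \<bar>x \<omega>\<bar> \<le> b"
    using assms by (auto simp: bdd_measurable_def bounded_iff)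
  \<comment> \<open>If \<open>\<Omega>\<close> is empty, the bound \<open>b\<close> is vacuous and
    may be negative.\<close>
  have "x \<omega> \<le> max b 0" if "\<omega> \<in> \<Omega>" for \<omega>
    using b[OF that] by linarith
  then show ?thesis
    by (intro exI[of _ "max b 0"]) simp
qed

lemma superlevel_sets:
  assumes "x \<in> bdd_measurable \<Omega> \<A>" "sigma_algebra \<Omega> \<A>"
  shows "{\<omega> \<in> \<Omega>. x \<omega> \<ge> t} \<in> \<A>"
proof -
  have "x -` {t..} \<inter> \<Omega> \<in> \<A>"
    using assms(1) by (auto simp: bdd_measurable_iff[OF assms(2)])
  moreover have "x -` {t..} \<inter> \<Omega> = {\<omega> \<in> \<Omega>. x \<omega> \<ge> t}" by auto
  ultimately show ?thesis by simp
qed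

lemma indicator_bdd_measurable:
  assumes "A \<in> \<A>" "sigma_algebra \<Omega> \<A>"
  shows "(\<lambda>\<omega>. c * indicator A \<omega>) \<in> bdd_measurable \<Omega> \<A>"
proof -
  interpret sigma_algebra \<Omega> \<A> by fact
  have [measurable]: "A \<in> sets (sigma \<Omega> \<A>)"
    using assms by simp
  have "(\<lambda>\<omega>. c * indicator A \<omega>) \<in> borel_measurable (sigma \<Omega> \<A>)"
    by measurable
  moreover have "A \<subseteq> \<Omega>"
    using assms sets_into_space by blast
  ultimately show ?thesis
    by (auto simp: bdd_measurable_def bounded_iff indicator_def intro!: exI[of _ "\<bar>c\<bar>"])
qed

lemma antimono_capacity_superlevel:
  assumes "capacity \<A> v" "x \<in> bdd_measurable \<Omega> \<A>" "sigma_algebra \<Omega> \<A>"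
  shows "antimono_on T (\<lambda>t. v {\<omega> \<in> \<Omega>. x \<omega> \<ge> t})"
proof (rule monotone_onI)
  fix s t :: real assume "s \<le> t"
  then have "{\<omega> \<in> \<Omega>. x \<omega> \<ge> t} \<subseteq> {\<omega> \<in> \<Omega>. x \<omega> \<ge> s}"
    by auto
  then show "v {\<omega> \<in> \<Omega>. x \<omega> \<ge> t} \<le> v {\<omega> \<in> \<Omega>. x \<omega> \<ge> s}"
    using assms(1) superlevel_sets[OF assms(2,3)] by (simp add: capacity_def)
qed

text \<open>The superlevel sets of \<open>x\<close> and of \<open>x\<^sup>+\<close> may differ at \<open>t = 0\<close>, which the integral does not see.\<close>

lemma choquet_integral_pos_part:
  assumes v: "v {} = 0" and "0 \<le> b" and b: "\<And>\<omega>. \<omega> \<in> \<Omega> \<Longrightarrow> x \<omega> \<le> b"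
  shows "choquet_integral \<Omega> v (pos_part x) = integral {0..b} (\<lambda>t. v {\<omega> \<in> \<Omega>. x \<omega> \<ge> t})"
proof -
  let ?G = "\<lambda>t. v {\<omega> \<in> \<Omega>. x \<omega> \<ge> t}"
  have *: "{\<omega> \<in> \<Omega>. pos_part x \<omega> \<ge> t} = \<Omega>" if "t \<le> 0" for t
    using that by (auto simp: pos_part_def)
  have "integral {..0} (\<lambda>t. v {\<omega> \<in> \<Omega>. pos_part x \<omega> \<ge> t} - v \<Omega>) = integral {..0::real} (\<lambda>t. 0)"
    by (intro Henstock_Kurzweil_Integration.integral_cong) (simp add: *)
  moreover have "integral {0..} (\<lambda>t. v {\<omega> \<in> \<Omega>. pos_part x \<omega> \<ge> t}) =
      integral {0..} (\<lambda>t. if t \<in> {0..b} then ?G t else 0)"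
  proof (rule integral_spike[of "{0}"])
    fix t :: real assume t: "t \<in> {0..} - {0}"
    have "{\<omega> \<in> \<Omega>. pos_part x \<omega> \<ge> t} = {\<omega> \<in> \<Omega>. x \<omega> \<ge> t}"
      using t by (auto simp: pos_part_def)
    moreover have "?G t = 0" if "\<not> t \<le> b"
    proof -
      have "{\<omega> \<in> \<Omega>. x \<omega> \<ge> t} = {}"
        using b that by force
      then show ?thesis
        using v by metis
    qed
    ultimately show "(if t \<in> {0..b} then ?G t else 0) = v {\<omega> \<in> \<Omega>. pos_part x \<omega> \<ge> t}"
      using t by auto
  qed simp
  moreover have "\<dots> = integral {0..b} ?G"
    unfolding Henstock_Kurzweil_Integration.integral_restrict_Int
    by (rule arg_cong[where f = "\<lambda>S. integral S ?G"]) auto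
  ultimately show ?thesis
    by (simp add: choquet_integral_def)
qed

section \<open>The Sipos integral under negation and parity\<close>

lemma sipos_integral_uminus:
  "sipos_integral \<Omega> v (\<lambda>\<omega>. - x \<omega>) = - sipos_integral \<Omega> v x"
  by (simp add: sipos_integral_def neg_part_conv_pos_part)

text \<open>The layers of \<open>x\<close> below height \<open>k\<close> belong to the certificate
  and those above to the call. All of the negative part of \<open>x\<close> stays with the
  certificate.\<close>

lemma sipos_integral_DCP:
  assumes \<Omega>: "sigma_algebra \<Omega> \<A>" and v: "capacity \<A> v"
    and x: "x \<in> bdd_measurable \<Omega> \<A>" and k: "0 \<le> k"
  shows "sipos_integral \<Omega> v x =
    sipos_integral \<Omega> v (call_option \<Omega> x k) + sipos_integral \<Omega> v (discount_certificate \<Omega> x k)"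
proof -
  let ?G = "\<lambda>t. v {\<omega> \<in> \<Omega>. x \<omega> \<ge> t}"
  let ?y = "\<lambda>\<omega>. x \<omega> - k * indicator \<Omega> \<omega>"
  have v0: "v {} = 0"
    using v by (simp add: capacity_def)
  have x0: "x \<omega> = 0" if "\<omega> \<notin> \<Omega>" for \<omega>
    using x that by (simp add: bdd_measurable_def)
  obtain b where b: "0 \<le> b" "\<And>\<omega>. \<omega> \<in> \<Omega> \<Longrightarrow> x \<omega> \<le> b"
    using bdd_measurable_le[OF x] by blast
  \<comment> \<open>Any nonnegative upper bound of \<open>x\<close> may serve as the end point. With
    \<open>b + k\<close> the interval contains \<open>k\<close>, and its upper piece shifts to
    \<open>[0, b]\<close>.\<close>
  have "choquet_integral \<Omega> v (pos_part x) = integral {0..b + k} ?G"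
    using b k by (intro choquet_integral_pos_part v0) (auto intro: add_increasing2)
  also have "\<dots> = integral {0..k} ?G + integral {k..b + k} ?G"
    using b k antimono_capacity_superlevel[OF v x \<Omega>]
    by (intro Henstock_Kurzweil_Integration.integral_combine[symmetric] integrable_on_antimono_on) auto
  also have "integral {0..k} ?G = integral {0..k} (\<lambda>t. v {\<omega> \<in> \<Omega>. discount_certificate \<Omega> x k \<omega> \<ge> t})"
    by (intro Henstock_Kurzweil_Integration.integral_cong arg_cong[where f = v])
      (auto simp: discount_certificate_def)
  also have "\<dots> = choquet_integral \<Omega> v (pos_part (discount_certificate \<Omega> x k))"
    using k by (intro choquet_integral_pos_part[symmetric] v0) (auto simp: discount_certificate_def)
  also have "integral {k..b + k} ?G = integral {0..b} (\<lambda>t. ?G (t + k))"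
    using integral_shift_real_ivl[of k k "b + k" ?G] by simp
  also have "\<dots> = integral {0..b} (\<lambda>t. v {\<omega> \<in> \<Omega>. ?y \<omega> \<ge> t})"
    by (intro Henstock_Kurzweil_Integration.integral_cong arg_cong[where f = v]) auto
  also have "\<dots> = choquet_integral \<Omega> v (pos_part ?y)"
    using b k by (intro choquet_integral_pos_part[symmetric] v0) (auto simp: diff_le_eq intro: add_increasing2)
  also have "pos_part ?y = pos_part (call_option \<Omega> x k)"
    by (auto simp: call_option_def pos_part_def)
  finally have pos: "choquet_integral \<Omega> v (pos_part x) =
      choquet_integral \<Omega> v (pos_part (discount_certificate \<Omega> x k)) +
      choquet_integral \<Omega> v (pos_part (call_option \<Omega> x k))" .
  have "neg_part (discount_certificate \<Omega> x k) = neg_part x"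
    using k x0 by (auto simp: neg_part_def discount_certificate_def indicator_def fun_eq_iff)
  \<comment> \<open>The negated call is bounded above by 0, so its integral runs over the degenerate
    interval \<open>[0, 0]\<close>.\<close>
  moreover have "choquet_integral \<Omega> v (neg_part (call_option \<Omega> x k)) = 0"
    unfolding neg_part_conv_pos_part
    by (subst choquet_integral_pos_part[where b = 0]) (auto simp: v0 call_option_def pos_part_def)
  ultimately show ?thesis
    using pos by (simp add: sipos_integral_def)
qed

section \<open>From parity and the absence of spreads to the integral representation\<close>

locale parity_pricing =
  fixes \<Omega> :: "'a set" and \<A> :: "'a set set" and f :: "('a \<Rightarrow> real) \<Rightarrow> real"
  assumes \<Omega>: "sigma_algebra \<Omega> \<A>"
    and monotone: "monotone_rule \<Omega> \<A> f"
    and no_spreads: "no_bid_ask_spreads \<Omega> \<A> f"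
    and DCP: "DCP \<Omega> \<A> f"
begin

sublocale sigma_algebra \<Omega> \<A> by (rule \<Omega>)

definition price :: "'a set \<Rightarrow> real" where
  "price A = f (indicator A)"

lemma f_mono:
  "x \<in> bdd_measurable \<Omega> \<A> \<Longrightarrow> y \<in> bdd_measurable \<Omega> \<A> \<Longrightarrow> (\<And>\<omega>. \<omega> \<in> \<Omega> \<Longrightarrow> x \<omega> \<le> y \<omega>) \<Longrightarrow> f x \<le> f y"
  using monotone by (auto simp: monotone_rule_def)

lemma f_uminus: "x \<in> bdd_measurable \<Omega> \<A> \<Longrightarrow> f (\<lambda>\<omega>. - x \<omega>) = - f x"
  using no_spreads by (simp add: no_bid_ask_spreads_def)

lemma f_parity:
  "x \<in> bdd_measurable \<Omega> \<A> \<Longrightarrow> 0 \<le> k \<Longrightarrow>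
    f x = f (call_option \<Omega> x k) + f (discount_certificate \<Omega> x k)"
  using DCP by (simp add: DCP_def)

lemma f_zero: "f (\<lambda>\<omega>. 0) = 0"
  using f_uminus[OF indicator_bdd_measurable[OF empty_sets \<Omega>, of 0]] by simp

lemma f_scaled_indicator:
  assumes A: "A \<in> \<A>" and "0 \<le> c"
  shows "f (\<lambda>\<omega>. c * indicator A \<omega>) = c * price A"
proof -
  let ?g = "\<lambda>c. f (\<lambda>\<omega>. c * indicator A \<omega>)"
  have meas: "(\<lambda>\<omega>. c * indicator A \<omega>) \<in> bdd_measurable \<Omega> \<A>" for c
    using A \<Omega> by (rule indicator_bdd_measurable)
  have sub: "A \<subseteq> \<Omega>"
    using A sets_into_space by blast
  have "?g c = c * ?g 1"
  proof (rule additive_mono_on_nonneg_linear)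
    fix s t :: real assume st: "0 \<le> s" "0 \<le> t"
    \<comment> \<open>The strike \<open>s\<close> cuts the block of height \<open>s + t\<close> over
      \<open>A\<close> into blocks of heights \<open>t\<close> and \<open>s\<close>, so DCP becomes
      additivity in the height.\<close>
    have "call_option \<Omega> (\<lambda>\<omega>. (s + t) * indicator A \<omega>) s = (\<lambda>\<omega>. t * indicator A \<omega>)"
      using st sub by (auto simp: call_option_def pos_part_def indicator_def fun_eq_iff)
    moreover have "discount_certificate \<Omega> (\<lambda>\<omega>. (s + t) * indicator A \<omega>) s = (\<lambda>\<omega>. s * indicator A \<omega>)"
      using st sub by (auto simp: discount_certificate_def indicator_def fun_eq_iff)
    ultimately show "?g (s + t) = ?g s + ?g t"
      using f_parity[OF meas \<open>0 \<le> s\<close>, of "s + t"] by simp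
  next
    show "mono_on {0..} ?g"
      by (auto simp: monotone_on_def intro!: f_mono meas mult_right_mono)
  qed fact
  then show ?thesis
    by (simp add: price_def)
qed

lemma capacity_price: "capacity \<A> price"
proof -
  have "(indicator A :: 'a \<Rightarrow> real) \<in> bdd_measurable \<Omega> \<A>" if "A \<in> \<A>" for A
    using indicator_bdd_measurable[OF that \<Omega>, of 1] by simp
  moreover have "(indicator {} :: 'a \<Rightarrow> real) = (\<lambda>\<omega>. 0)"
    by auto
  ultimately show ?thesis
    by (auto simp: capacity_def price_def f_zero indicator_def intro!: f_mono)
qed

lemma f_slice_bounds:
  assumes x: "x \<in> bdd_measurable \<Omega> \<A>" and st: "0 \<le> s" "s \<le> t"
  shows "(t - s) * price {\<omega> \<in> \<Omega>. x \<omega> \<ge> t} \<le>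
      f (discount_certificate \<Omega> x t) - f (discount_certificate \<Omega> x s)"
    and "f (discount_certificate \<Omega> x t) - f (discount_certificate \<Omega> x s) \<le>
      (t - s) * price {\<omega> \<in> \<Omega>. x \<omega> \<ge> s}"
proof -
  let ?d = "discount_certificate \<Omega> x t"
  have d: "?d \<in> bdd_measurable \<Omega> \<A>"
    using x \<Omega> st by (intro discount_certificate_bdd_measurable) auto
  then have c: "call_option \<Omega> ?d s \<in> bdd_measurable \<Omega> \<A>"
    using \<Omega> st by (intro call_option_bdd_measurable) auto
  \<comment> \<open>Capping at \<open>t\<close> and then at \<open>s \<le> t\<close> is capping at
    \<open>s\<close>. DCP for the capped claim \<open>?d\<close> therefore prices the difference of
    the certificates as a call.\<close>
  have "discount_certificate \<Omega> ?d s = discount_certificate \<Omega> x s"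
    using st by (auto simp: discount_certificate_def indicator_def fun_eq_iff)
  with f_parity[OF d \<open>0 \<le> s\<close>]
  have slice: "f ?d - f (discount_certificate \<Omega> x s) = f (call_option \<Omega> ?d s)"
    by simp
  have ind: "(\<lambda>\<omega>. (t - s) * indicator {\<omega> \<in> \<Omega>. x \<omega> \<ge> r} \<omega>) \<in> bdd_measurable \<Omega> \<A>"
    "f (\<lambda>\<omega>. (t - s) * indicator {\<omega> \<in> \<Omega>. x \<omega> \<ge> r} \<omega>) = (t - s) * price {\<omega> \<in> \<Omega>. x \<omega> \<ge> r}" for r
    using superlevel_sets[OF x \<Omega>, of r] \<Omega> st
    by (auto intro!: indicator_bdd_measurable f_scaled_indicator)
  \<comment> \<open>The slice takes values in \<open>[0, t - s]\<close>, equals \<open>t - s\<close>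
    where \<open>x \<ge> t\<close> and vanishes where \<open>x < s\<close>.\<close>
  have "f (\<lambda>\<omega>. (t - s) * indicator {\<omega> \<in> \<Omega>. x \<omega> \<ge> t} \<omega>) \<le> f (call_option \<Omega> ?d s)"
    using st by (intro f_mono ind c)
      (auto simp: call_option_def discount_certificate_def pos_part_def indicator_def)
  then show "(t - s) * price {\<omega> \<in> \<Omega>. x \<omega> \<ge> t} \<le> f ?d - f (discount_certificate \<Omega> x s)"
    by (simp add: slice ind)
  have "f (call_option \<Omega> ?d s) \<le> f (\<lambda>\<omega>. (t - s) * indicator {\<omega> \<in> \<Omega>. x \<omega> \<ge> s} \<omega>)"
    using st by (intro f_mono ind c)
      (auto simp: call_option_def discount_certificate_def pos_part_def indicator_def)
  then show "f ?d - f (discount_certificate \<Omega> x s) \<le> (t - s) * price {\<omega> \<in> \<Omega>. x \<omega> \<ge> s}"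
    by (simp add: slice ind)
qed

text \<open>Stated for the positive part of an arbitrary \<open>x\<close>, so that replacing
  \<open>x\<close> by its negative covers the negative part too.\<close>

lemma f_pos_part:
  assumes "x \<in> bdd_measurable \<Omega> \<A>"
  shows "f (pos_part x) = choquet_integral \<Omega> price (pos_part x)"
proof -
  define p where "p = pos_part x"
  have p: "p \<in> bdd_measurable \<Omega> \<A>"
    unfolding p_def using assms \<Omega> by (rule pos_part_bdd_measurable)
  have p0: "p \<omega> \<ge> 0" "pos_part p = p" for \<omega>
    by (auto simp: p_def pos_part_def)
  have out: "p \<omega> = 0" if "\<omega> \<notin> \<Omega>" for \<omega>
    using p that by (simp add: bdd_measurable_def)
  obtain b where b: "0 \<le> b" "\<And>\<omega>. \<omega> \<in> \<Omega> \<Longrightarrow> p \<omega> \<le> b"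
    using bdd_measurable_le[OF p] by blast
  have "choquet_integral \<Omega> price p = integral {0..b} (\<lambda>t. price {\<omega> \<in> \<Omega>. p \<omega> \<ge> t})"
    using choquet_integral_pos_part[where x = p and v = price] b capacity_price
    by (simp add: p0 capacity_def)
  \<comment> \<open>Here \<open>F t\<close> is the price of \<open>p\<close> capped at
    \<open>t\<close>, and \<open>G t\<close> is the price of its superlevel set. The cap
    \<open>b\<close> leaves \<open>p\<close> unchanged and the cap 0 leaves the zero claim.\<close>
  also have "\<dots> = f (discount_certificate \<Omega> p b) - f (discount_certificate \<Omega> p 0)"
    using f_slice_bounds[OF p] b(1) antimono_capacity_superlevel[OF capacity_price p \<Omega>]
    by (intro integral_eq_increment) auto
  also have "discount_certificate \<Omega> p b = p"
    using b out by (auto simp: discount_certificate_def indicator_def fun_eq_iff min_def dest: order.antisym)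
  also have "discount_certificate \<Omega> p 0 = (\<lambda>\<omega>. 0)"
    using p0 by (auto simp: discount_certificate_def)
  finally show ?thesis
    by (simp add: f_zero p_def)
qed

text \<open>At strike 0 the call is the positive part and the certificate is minus the negative
  part. The absence of spreads moves that sign outside \<open>f\<close>.\<close>

lemma f_eq_sipos_integral:
  assumes x: "x \<in> bdd_measurable \<Omega> \<A>"
  shows "f x = sipos_integral \<Omega> price x"
proof -
  have "call_option \<Omega> x 0 = pos_part x"
    "discount_certificate \<Omega> x 0 = (\<lambda>\<omega>. - neg_part x \<omega>)"
    by (auto simp: call_option_def discount_certificate_def neg_part_def)
  then have "f x = f (pos_part x) - f (neg_part x)"
    using f_parity[OF x, of 0] f_uminus[OF neg_part_bdd_measurable[OF x \<Omega>]] by simp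
  also have "\<dots> = sipos_integral \<Omega> price x"
    using f_pos_part[OF x] f_pos_part[OF uminus_bdd_measurable[OF x \<Omega>]]
    by (simp add: sipos_integral_def neg_part_conv_pos_part)
  finally show ?thesis .
qed

end

theorem theorem3:
  fixes \<Omega> :: "'a set" and \<A> :: "'a set set" and f :: "('a \<Rightarrow> real) \<Rightarrow> real"
  assumes "sigma_algebra \<Omega> \<A>"
    and "pricing_rule \<Omega> \<A> f"
    and "monotone_rule \<Omega> \<A> f"
  shows "no_bid_ask_spreads \<Omega> \<A> f \<and> DCP \<Omega> \<A> f \<longleftrightarrow> sipos_pricing_rule \<Omega> \<A> f"
proof
  assume "no_bid_ask_spreads \<Omega> \<A> f \<and> DCP \<Omega> \<A> f"
  then interpret parity_pricing \<Omega> \<A> f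
    using assms by (simp add: parity_pricing_def)
  show "sipos_pricing_rule \<Omega> \<A> f"
    using capacity_price f_eq_sipos_integral by (auto simp: sipos_pricing_rule_def)
next
  assume "sipos_pricing_rule \<Omega> \<A> f"
  then obtain v where v: "capacity \<A> v"
    and f: "\<And>x. x \<in> bdd_measurable \<Omega> \<A> \<Longrightarrow> f x = sipos_integral \<Omega> v x"
    by (auto simp: sipos_pricing_rule_def)
  have "no_bid_ask_spreads \<Omega> \<A> f"
    using assms(1)
    by (auto simp: no_bid_ask_spreads_def f uminus_bdd_measurable sipos_integral_uminus)
  moreover have "DCP \<Omega> \<A> f"
    unfolding DCP_def
  proof (intro ballI allI impI)
    fix x and k :: real assume x: "x \<in> bdd_measurable \<Omega> \<A>" and k: "0 \<le> k"
    show "f x = f (call_option \<Omega> x k) + f (discount_certificate \<Omega> x k)"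
      using sipos_integral_DCP[OF assms(1) v x k]
      unfolding f[OF x] f[OF call_option_bdd_measurable[OF x assms(1) k]]
        f[OF discount_certificate_bdd_measurable[OF x assms(1) k]] .
  qed
  ultimately show "no_bid_ask_spreads \<Omega> \<A> f \<and> DCP \<Omega> \<A> f" ..
qed

end
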